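(* For every integer $k\ge 0$ the following identities between rational functions of $x$ hold: $$\delta_k(x)=\sum_{i=0}^k\binom{x-1}{i}\,\overline{\sigma}_{k-i}(x-i),\qquad \delta_k(k-x)=\sum_{i=0}^k\binom{k-x-1}{k-i}\,\overline{\sigma}_i(i-x);$$ $$\overline{\sigma}_k(x)=\sum_{i=0}^k(-1)^i\binom{x-1}{i}\,\delta_{k-i}(x-i),\qquad \overline{\sigma}_k(k-x)=\sum_{i=0}^k(-1)^{k-i}\binom{k-x-1}{k-i}\,\delta_i(i-x).$$
   Context: Binomial coefficients are $\binom{y}{j}=y(y-1)\cdots(y-j+1)/j!$, and $x^{\underline{k+1}}=x(x-1)\cdots(x-k)$. Let $s(n,m)=(-2)^{n-m}c(n,m)$ with $c(n,m)$ the unsigned Stirling numbers of the first kind, and let $\theta(n,m)$ be defined by $\sum_n\theta(n,m)\frac{u^n}{n!}=\frac1{m!}(\operatorname{artanh}u)^m$ for integers $n,m\ge0$. For each fixed integer $k\ge0$, $s(n,n-k)$ and $\theta(n,n-k)$, for integers $n\ge k$, are the values at $x=n$ of unique polynomials in $x$, denoted $s(x,x-k)$ and $\theta(x,x-k)$. The (scaled) Stirling polynomials and the tanh polynomials are $$\overline{\sigma}_k(x)=\frac{s(x,x-k)}{x^{\underline{k+1}}},\qquad \delta_k(x)=\frac{\theta(x,x-k)}{x^{\underline{k+1}}}.$$ (They are polynomials for $k\ge1$, while $\overline{\sigma}_0(x)=\delta_0(x)=1/x$.) *)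

theory Defs
  imports
    "HOL-Combinatorics.Stirling"
    "HOL-Computational_Algebra.Computational_Algebra"
begin

definition scaled_stirling :: "nat \<Rightarrow> nat \<Rightarrow> rat" where
  "scaled_stirling n m = (-2) ^ (n - m) * of_nat (stirling n m)"

definition fps_artanh :: "rat fps" where
  "fps_artanh = Abs_fps (\<lambda>n. if odd n then 1 / of_nat n else 0)"

(* The coefficient of u^n in artanh(u)^m / m! is theta(n,m) / n!. *)
definition artanh_number :: "nat \<Rightarrow> nat \<Rightarrow> rat" where
  "artanh_number n m = fact n * fps_nth (fps_const (1 / fact m) * fps_artanh ^ m) n"

(* For f = s and f = theta this is f(x,x-k) as a polynomial in x; existence and uniqueness are
   established in diagonal_stirling_ex1 and diagonal_artanh_ex1 below. *)
definition diagonal_poly :: "(nat \<Rightarrow> nat \<Rightarrow> rat) \<Rightarrow> nat \<Rightarrow> rat poly" where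
  "diagonal_poly f k = (THE p. \<forall>n\<ge>k. poly p (of_nat n) = f n (n - k))"

(* The rational function p(x) / (x (x-1) ... (x-k)), evaluated at an element y of a field
   extension of the rationals. With y in Q(x), this covers substitutions such as x \<mapsto> k - x.
   The value is meaningful only for y outside {0, ..., k}. *)
definition over_falling :: "rat poly \<Rightarrow> nat \<Rightarrow> 'a::field_char_0 \<Rightarrow> 'a" where
  "over_falling p k y = poly (map_poly of_rat p) y / (\<Prod>j\<le>k. y - of_nat j)"

definition stirling_polynomial :: "nat \<Rightarrow> 'a::field_char_0 \<Rightarrow> 'a" where
  "stirling_polynomial k = over_falling (diagonal_poly scaled_stirling k) k"

definition tanh_polynomial :: "nat \<Rightarrow> 'a::field_char_0 \<Rightarrow> 'a" where
  "tanh_polynomial k = over_falling (diagonal_poly artanh_number k) k"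

lemma fps_deriv_artanh: "fps_deriv fps_artanh * (1 - fps_X ^ 2) = 1"
proof (rule fps_ext)
  fix n
  have 1: "fps_nth (fps_deriv fps_artanh) j = (if even j then 1 else 0)" for j
    by (simp add: fps_artanh_def del: of_nat_Suc)
  have "fps_deriv fps_artanh * (1 - fps_X ^ 2) = fps_deriv fps_artanh - fps_X ^ 2 * fps_deriv fps_artanh"
    by (simp add: algebra_simps)
  hence "fps_nth (fps_deriv fps_artanh * (1 - fps_X ^ 2)) n =
      fps_nth (fps_deriv fps_artanh) n - fps_nth (fps_X ^ 2 * fps_deriv fps_artanh) n"
    by (simp only: fps_sub_nth)
  also have "\<dots> = fps_nth 1 n"
    unfolding fps_X_power_mult_nth 1 by (cases "n < 2") (auto simp: less_2_cases_iff)
  finally show "fps_nth (fps_deriv fps_artanh * (1 - fps_X ^ 2)) n = fps_nth 1 n" .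
qed

lemma artanh_number_0 [simp]: "artanh_number 0 m = (if m = 0 then 1 else 0)"
  by (simp add: artanh_number_def fps_power_zeroth fps_artanh_def)

lemma artanh_number_0_right: "artanh_number n 0 = (if n = 0 then 1 else 0)"
  by (simp add: artanh_number_def)

lemma artanh_number_less: "n < m \<Longrightarrow> artanh_number n m = 0"
  by (simp add: artanh_number_def startsby_zero_power_prefix fps_artanh_def)

lemma artanh_number_rec:
  "artanh_number (Suc n) (Suc m) =
     artanh_number n m + of_nat n * (of_nat n - 1) * artanh_number (n - 1) (Suc m)"
proof -
  define F where "F = (\<lambda>m. fps_const (1 / fact m :: rat) * fps_artanh ^ m)"
  have "fps_deriv (F (Suc m)) = fps_const (1 / fact (Suc m)) * (fps_const (of_nat (Suc m)) *
      fps_deriv fps_artanh * fps_artanh ^ m)"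
    unfolding F_def by (simp only: fps_deriv_mult fps_deriv_const fps_deriv_power) simp
  also have "\<dots> = fps_const (of_nat (Suc m) / fact (Suc m)) * fps_deriv fps_artanh * fps_artanh ^ m"
    by (simp only: mult.assoc [symmetric] fps_const_mult) (simp add: mult.commute)
  also have "of_nat (Suc m) / fact (Suc m) = (1 / fact m :: rat)"
    by (simp add: divide_simps del: of_nat_Suc)
  finally have "fps_deriv (F (Suc m)) = fps_deriv fps_artanh * F m"
    by (simp add: F_def mult_ac)
  hence "fps_deriv (F (Suc m)) * (1 - fps_X ^ 2) = F m * (fps_deriv fps_artanh * (1 - fps_X ^ 2))"
    by (simp only: mult_ac)
  hence "fps_deriv (F (Suc m)) * (1 - fps_X ^ 2) = F m"
    by (simp only: fps_deriv_artanh mult_1_right)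
  hence "fps_nth (fps_deriv (F (Suc m)) * (1 - fps_X ^ 2)) n = fps_nth (F m) n"
    by simp
  hence eq: "of_nat (Suc n) * fps_nth (F (Suc m)) (Suc n) -
      (if n < 2 then 0 else of_nat (n - 1) * fps_nth (F (Suc m)) (n - 1)) = fps_nth (F m) n"
    by (simp add: algebra_simps fps_X_power_mult_right_nth split: if_splits)
       (auto simp: numeral_2_eq_2 Suc_diff_Suc algebra_simps)
  have A: "artanh_number n m = fact n * fps_nth (F m) n" for n m
    by (simp add: artanh_number_def F_def)
  show ?thesis
  proof (cases "n < 2")
    case True
    hence "n = 0 \<or> n = 1" by auto
    thus ?thesis using eq by (auto simp: A)
  next
    case False
    hence n: "fact n = (of_nat n * fact (n - 1) :: rat)" "(of_nat (n - 1) :: rat) = of_nat n - 1"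
      by (simp_all add: fact_reduce of_nat_diff)
    have "artanh_number (Suc n) (Suc m) = fact n * (of_nat (Suc n) * fps_nth (F (Suc m)) (Suc n))"
      by (simp add: A algebra_simps)
    also have "of_nat (Suc n) * fps_nth (F (Suc m)) (Suc n) =
        fps_nth (F m) n + (of_nat n - 1) * fps_nth (F (Suc m)) (n - 1)"
      using eq False n(2) by (simp del: of_nat_Suc add: algebra_simps)
    also have "fact n * \<dots> = artanh_number n m +
        of_nat n * (of_nat n - 1) * artanh_number (n - 1) (Suc m)"
      unfolding A distrib_left by (subst (2) n(1)) (simp only: mult_ac)
    finally show ?thesis .
  qed
qed

lemma poly_antidifference:
  fixes q :: "rat poly"
  shows "\<exists>p. \<forall>x. poly p (x + 1) - poly p x = poly q x"
proof -
  have "\<exists>p. pcompose p [:1, 1:] - p = q" if "\<forall>i\<ge>d. coeff q i = 0" for d and q :: "rat poly"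
    using that
  proof (induction d arbitrary: q)
    case 0
    hence "q = 0" by (simp add: poly_eq_iff)
    thus ?case by (intro exI[of _ 0]) simp
  next
    case (Suc d)
    define m where "m = monom (coeff q d / of_nat (Suc d)) (Suc d)"
    define q' where "q' = q - (pcompose m [:1, 1:] - m)"
    have m: "pcompose m [:1, 1:] = smult (coeff q d / of_nat (Suc d)) ([:1, 1:] ^ Suc d)"
      by (intro poly_eq_poly_eq_iff [THEN iffD1] ext)
         (simp add: m_def poly_pcompose poly_monom del: of_nat_Suc power_Suc)
    have "coeff q' i = 0" if ge: "i \<ge> d" for i
    proof -
      consider "i = d" | "i = Suc d" | "i > Suc d" using ge by linarith
      thus ?thesis
      proof cases
        case 1
        have "coeff (pcompose m [:1, 1:]) d = coeff q d"
          by (simp add: m coeff_linear_poly_power del: of_nat_Suc power_Suc)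
        thus ?thesis by (simp add: q'_def 1) (simp add: m_def)
      next
        case 2
        have "coeff (pcompose m [:1, 1:]) (Suc d) = coeff q d / of_nat (Suc d)"
          by (simp add: m coeff_linear_poly_power del: of_nat_Suc power_Suc)
        thus ?thesis using Suc.prems by (simp add: q'_def 2) (simp add: m_def)
      next
        case 3
        have "coeff (pcompose m [:1, 1:]) i = 0"
          using 3 by (simp add: m coeff_eq_0 degree_linear_power del: of_nat_Suc power_Suc)
        thus ?thesis using Suc.prems 3 by (simp add: q'_def) (simp add: m_def)
      qed
    qed
    then obtain p where p: "pcompose p [:1, 1:] - p = q'" using Suc.IH by blast
    show ?case
      by (rule exI[of _ "p + m"]) (use p in \<open>simp add: pcompose_add q'_def algebra_simps\<close>)
  qed
  from this[of "Suc (degree q)" q] obtain p where p: "pcompose p [:1, 1:] - p = q"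
    by (auto simp: coeff_eq_0)
  have "poly p (x + 1) - poly p x = poly q x" for x
    by (subst p [symmetric]) (simp add: poly_pcompose add.commute)
  thus ?thesis by blast
qed

lemma poly_interpolates:
  fixes g :: "nat \<Rightarrow> rat" and q :: "rat poly"
  assumes "\<And>n. n \<ge> k \<Longrightarrow> g (Suc n) = g n + poly q (of_nat n)"
  shows "\<exists>p. \<forall>n\<ge>k. poly p (of_nat n) = g n"
proof -
  obtain p where p: "\<And>x. poly p (x + 1) - poly p x = poly q x"
    using poly_antidifference by blast
  define p' where "p' = p + [:g k - poly p (of_nat k):]"
  have "poly p' (of_nat n) = g n" if "n \<ge> k" for n
    using that
  proof (induction n rule: dec_induct)
    case base
    show ?case by (simp add: p'_def)
  next
    case (step n)
    thus ?case using assms[of n] p[of "of_nat n"] by (simp add: p'_def add.commute)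
  qed
  thus ?thesis by blast
qed

lemma poly_nat_unique:
  fixes p q :: "rat poly"
  assumes "\<forall>n\<ge>k. poly p (of_nat n) = poly q (of_nat n)"
  shows "p = q"
proof (rule ccontr)
  assume "p \<noteq> q"
  hence "finite {x. poly (p - q) x = 0}" by (intro poly_roots_finite) simp
  moreover have "of_nat ` {k..} \<subseteq> {x. poly (p - q) x = 0}" using assms by auto
  ultimately have "finite (of_nat ` {k..} :: rat set)" by (rule rev_finite_subset)
  thus False by (simp add: finite_image_iff inj_on_def infinite_Ici)
qed

lemma diagonal_stirling_ex1:
  "\<exists>!p. \<forall>n\<ge>k. poly p (of_nat n) = scaled_stirling n (n - k)"
proof -
  have "\<exists>p. \<forall>n\<ge>k. poly p (of_nat n) = scaled_stirling n (n - k)"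
  proof (induction k)
    case 0
    show ?case by (intro exI[of _ 1]) (simp add: scaled_stirling_def)
  next
    case (Suc k)
    then obtain r where r: "\<And>n. n \<ge> k \<Longrightarrow> poly r (of_nat n) = scaled_stirling n (n - k)" by blast
    show ?case
    proof (rule poly_interpolates)
      fix n assume n: "n \<ge> Suc k"
      define m where "m = n - Suc k"
      have "n = Suc (m + k)" using n by (simp add: m_def)
      thus "scaled_stirling (Suc n) (Suc n - Suc k) =
          scaled_stirling n (n - Suc k) + poly ([:0, -2:] * r) (of_nat n)"
        using r[of n] by (simp add: scaled_stirling_def algebra_simps Suc_diff_le)
    qed
  qed
  thus ?thesis using poly_nat_unique by (metis (no_types, lifting))
qed

lemma diagonal_artanh_ex1:
  "\<exists>!p. \<forall>n\<ge>k. poly p (of_nat n) = artanh_number n (n - k)"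
proof -
  have "\<exists>p. \<forall>n\<ge>k. poly p (of_nat n) = artanh_number n (n - k)"
  proof (induction k rule: less_induct)
    case (less k)
    have "\<exists>q. \<forall>n\<ge>k. of_nat n * (of_nat n - 1) * artanh_number (n - 1) (Suc (n - k)) = poly q (of_nat n)"
    proof (cases "k < 2")
      case True
      have "of_nat n * (of_nat n - 1) * artanh_number (n - 1) (Suc (n - k)) = 0" if "n \<ge> k" for n
        using True that by (cases "n = 0") (auto simp: artanh_number_less)
      thus ?thesis by (intro exI[of _ 0]) auto
    next
      case False
      then obtain r where r: "\<And>n. n \<ge> k - 2 \<Longrightarrow> poly r (of_nat n) = artanh_number n (n - (k - 2))"
        using less.IH[of "k - 2"] by auto
      have "of_nat n * (of_nat n - 1) * artanh_number (n - 1) (Suc (n - k)) =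
          poly ([:0, 1:] * [:-1, 1:] * pcompose r [:-1, 1:]) (of_nat n)" if "n \<ge> k" for n
      proof -
        have "n - 1 - (k - 2) = Suc (n - k)" "n - 1 \<ge> k - 2" using that False by auto
        thus ?thesis using r[of "n - 1"] that False
          by (simp add: poly_pcompose of_nat_diff algebra_simps)
      qed
      thus ?thesis by blast
    qed
    then obtain q where q: "\<And>n. n \<ge> k \<Longrightarrow>
        of_nat n * (of_nat n - 1) * artanh_number (n - 1) (Suc (n - k)) = poly q (of_nat n)"
      by blast
    show ?case
    proof (rule poly_interpolates)
      fix n assume "n \<ge> k"
      thus "artanh_number (Suc n) (Suc n - k) = artanh_number n (n - k) + poly q (of_nat n)"
        using artanh_number_rec[of n "n - k"] q[of n] by (simp add: Suc_diff_le)
    qed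
  qed
  thus ?thesis using poly_nat_unique by (metis (no_types, lifting))
qed

end

theory Submission
  imports Defs
begin

text \<open>
  Both arrays of numbers come from powers of a power series: the scaled Stirling numbers from
  \<open>S(u) = ln (1 + 2u) / 2\<close> (lemma \<open>scaled_stirling_eq_egf_array\<close>) and the artanh numbers, by
  definition, from \<open>artanh u\<close>. Since \<open>artanh u = ln ((1 + u) / (1 - u)) / 2\<close> and
  \<open>(1 + u) / (1 - u) = 1 + 2 u / (1 - u)\<close>, the two series are related by a Moebius substitution:
  \<open>artanh u = S (u / (1 - u))\<close>, and inversely \<open>S(u) = artanh (u / (1 + u))\<close>.

  Substituting \<open>u / (1 - c u)\<close> into an exponential generating function multiplies its array by
  the matrix of Lah numbers \<open>c^i i! (n choose i) (n - 1 choose i)\<close>, where \<open>i\<close> is the distance from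
  the diagonal (lemma \<open>egf_array_moebius\<close>). This gives, for \<open>n > k\<close>,
  \<open>\<theta>(n, n-k) = \<Sum>i\<le>k. i! (n choose i) (n - 1 choose i) s(n-i, n-k)\<close> together with its inverse
  relation, which has the extra sign \<open>(-1)^i\<close>. On each diagonal both sides are polynomials in \<open>n\<close>,
  so the relation holds at every point of a field extension of the rationals. The factor
  \<open>i! (x choose i) = x (x-1) \<dots> (x-i+1)\<close> is precisely the quotient of the falling factorial
  \<open>x (x-1) \<dots> (x-k)\<close> by the falling factorial belonging to \<open>k - i\<close> and \<open>x - i\<close>, so dividing by the
  former leaves the first and the third identity (lemma \<open>diagonal_lah_relation\<close>). The other two
  are the same relations at the point \<open>k - x\<close>, with the order of summation reversed.
\<close>

section \<open>Arrays generated by powers of a power series\<close>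

definition egf_array :: "rat fps \<Rightarrow> nat \<Rightarrow> nat \<Rightarrow> rat" where
  "egf_array A n m = fact n * fps_nth (fps_const (1 / fact m) * A ^ m) n"

lemma artanh_number_eq_egf_array: "artanh_number = egf_array fps_artanh"
  by (simp add: fun_eq_iff artanh_number_def egf_array_def)

text \<open>The series \<open>ln (1 + 2u) / 2\<close>.\<close>

definition fps_half_ln :: "rat fps" where
  "fps_half_ln = Abs_fps (\<lambda>n. if n = 0 then 0 else (-2) ^ (n - 1) / of_nat n)"

lemma fps_deriv_half_ln: "fps_deriv fps_half_ln * (1 + 2 * fps_X) = 1"
proof (rule fps_ext)
  fix n
  have 1: "fps_nth (fps_deriv fps_half_ln) j = (-2) ^ j" for j
    by (simp add: fps_half_ln_def del: of_nat_Suc)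
  have "fps_deriv fps_half_ln * (1 + 2 * fps_X) =
      fps_deriv fps_half_ln + fps_const 2 * (fps_deriv fps_half_ln * fps_X)"
    by (simp add: algebra_simps numeral_fps_const)
  thus "fps_nth (fps_deriv fps_half_ln * (1 + 2 * fps_X)) n = fps_nth 1 n"
    by (cases n) (simp_all add: 1 del: fps_deriv_nth)
qed

lemma scaled_stirling_rec:
  "scaled_stirling (Suc n) (Suc m) =
     scaled_stirling n m - 2 * of_nat n * scaled_stirling n (Suc m)"
proof (cases "m < n")
  case True
  hence "n - m = Suc (n - Suc m)" by simp
  thus ?thesis by (simp add: scaled_stirling_def algebra_simps)
next
  case False
  thus ?thesis by (cases "m = n") (simp_all add: scaled_stirling_def)
qed

text \<open>
  Multiplying the derivative \<open>S' S^m / m!\<close> of \<open>S^(m+1) / (m+1)!\<close> by \<open>1 + 2u\<close> leaves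
  \<open>S^m / m!\<close>; comparing coefficients gives the recurrence of the scaled Stirling numbers.
\<close>

lemma egf_array_half_ln_rec:
  "egf_array fps_half_ln (Suc n) (Suc m) =
     egf_array fps_half_ln n m - 2 * of_nat n * egf_array fps_half_ln n (Suc m)"
proof -
  define F where "F = (\<lambda>m. fps_const (1 / fact m :: rat) * fps_half_ln ^ m)"
  have "fps_deriv (F (Suc m)) = fps_const (of_nat (Suc m) / fact (Suc m)) *
      (fps_deriv fps_half_ln * fps_half_ln ^ m)"
    unfolding F_def by (simp add: fps_deriv_power fps_const_mult [symmetric] mult_ac
        del: fps_const_mult of_nat_Suc fact_Suc power_Suc)
  also have "of_nat (Suc m) / fact (Suc m) = (1 / fact m :: rat)"
    by (simp add: divide_simps del: of_nat_Suc)
  finally have "fps_deriv (F (Suc m)) * (1 + 2 * fps_X) =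
      F m * (fps_deriv fps_half_ln * (1 + 2 * fps_X))"
    by (simp add: F_def mult_ac)
  hence "fps_deriv (F (Suc m)) * (1 + 2 * fps_X) = F m"
    by (simp only: fps_deriv_half_ln mult_1_right)
  hence "fps_deriv (F (Suc m)) + fps_const 2 * (fps_deriv (F (Suc m)) * fps_X) = F m"
    by (simp add: numeral_fps_const algebra_simps)
  hence "fps_nth (fps_deriv (F (Suc m)) + fps_const 2 * (fps_deriv (F (Suc m)) * fps_X)) n =
      fps_nth (F m) n"
    by simp
  hence "of_nat (Suc n) * fps_nth (F (Suc m)) (Suc n) =
      fps_nth (F m) n - 2 * of_nat n * fps_nth (F (Suc m)) n"
    by (cases n) (simp_all add: algebra_simps)
  moreover have A: "egf_array fps_half_ln n m = fact n * fps_nth (F m) n" for n m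
    by (simp add: egf_array_def F_def)
  have "egf_array fps_half_ln (Suc n) (Suc m) =
      fact n * (of_nat (Suc n) * fps_nth (F (Suc m)) (Suc n))"
    unfolding A by (simp add: algebra_simps)
  ultimately show ?thesis
    by (simp only: A right_diff_distrib mult_ac)
qed

lemma scaled_stirling_eq_egf_array: "scaled_stirling = egf_array fps_half_ln"
proof (intro ext)
  fix n m
  show "scaled_stirling n m = egf_array fps_half_ln n m"
  proof (induction n arbitrary: m)
    case 0
    show ?case
      by (cases m) (simp_all add: scaled_stirling_def egf_array_def fps_half_ln_def)
  next
    case (Suc n)
    show ?case
    proof (cases m)
      case 0
      thus ?thesis by (simp add: scaled_stirling_def egf_array_def)
    next
      case (Suc m')
      thus ?thesis
        by (simp only: scaled_stirling_rec egf_array_half_ln_rec Suc.IH)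
    qed
  qed
qed

section \<open>The substitution of \<open>u / (1 - c u)\<close>\<close>

definition fps_moebius :: "rat \<Rightarrow> rat fps" where
  "fps_moebius c = fps_X * inverse (1 - fps_const c * fps_X)"

lemma fps_moebius_nth_0 [simp]: "fps_nth (fps_moebius c) 0 = 0"
  by (simp add: fps_moebius_def)

lemma fps_moebius_mult: "fps_moebius c * (1 - fps_const c * fps_X) = fps_X"
  by (simp add: fps_moebius_def mult.assoc inverse_mult_eq_1)

lemma fps_deriv_moebius:
  "fps_deriv (fps_moebius c) * (1 - fps_const c * fps_X) ^ 2 = 1"
proof -
  let ?v = "fps_moebius c" and ?d = "1 - fps_const c * fps_X"
  have "fps_deriv (?v * ?d) = 1"
    by (simp add: fps_moebius_mult)
  hence "fps_deriv ?v * ?d - fps_const c * ?v = 1"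
    by (simp add: algebra_simps)
  hence "(fps_deriv ?v * ?d - fps_const c * ?v) * ?d = ?d"
    by simp
  moreover have "(a * d - w * v) * d = a * d ^ 2 - w * (v * d)" for a d v w :: "rat fps"
    by (simp add: power2_eq_square algebra_simps)
  ultimately have "fps_deriv ?v * ?d ^ 2 - fps_const c * fps_X = 1 - fps_const c * fps_X"
    by (simp only: fps_moebius_mult)
  thus ?thesis by (simp only: diff_add_cancel diff_eq_eq)
qed

lemma fps_moebius_power_nth:
  assumes "0 < j" "j \<le> n"
  shows "fps_nth (fps_moebius c ^ j) n = of_nat ((n - 1) choose (n - j)) * c ^ (n - j)"
proof -
  have "fps_moebius c ^ j = fps_X ^ j * inverse ((1 - fps_const c * fps_X) ^ j)"
    by (simp add: fps_moebius_def power_mult_distrib fps_inverse_power)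
  thus ?thesis using assms
    by (simp add: one_minus_const_fps_X_neg_power' fps_X_power_mult_nth)
qed

text \<open>
  Series with vanishing constant term are equal if their derivatives are. Each derivative is
  presented by its reciprocal, since these reciprocals are polynomials for both
  \<open>ln (1 + 2u) / 2\<close> and \<open>artanh u\<close>.
\<close>

lemma eq_compose_moebius:
  fixes A B :: "rat fps"
  assumes "fps_nth A 0 = 0" "fps_nth B 0 = 0"
    and A: "fps_deriv A * E = 1" and B: "fps_deriv B * D = 1"
    and E: "E = (1 - fps_const c * fps_X) ^ 2 * (D oo fps_moebius c)"
  shows "A = B oo fps_moebius c"
proof -
  let ?v = "fps_moebius c"
  have "(fps_deriv B oo ?v) * (D oo ?v) = 1"
    by (simp add: B fps_compose_mult_distrib [symmetric])
  moreover have "fps_deriv (B oo ?v) * E = ((fps_deriv B oo ?v) * (D oo ?v)) *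
      (fps_deriv ?v * (1 - fps_const c * fps_X) ^ 2)"
    by (simp add: fps_compose_deriv E mult_ac)
  ultimately have "fps_deriv (B oo ?v) * E = fps_deriv A * E"
    by (simp add: A fps_deriv_moebius)
  moreover have "E \<noteq> 0" using A by auto
  ultimately have "fps_deriv A = fps_deriv (B oo ?v)" by simp
  thus ?thesis using assms(1,2) by (simp add: fps_deriv_eq_iff)
qed

lemma artanh_eq_half_ln_moebius: "fps_artanh = fps_half_ln oo fps_moebius 1"
proof (rule eq_compose_moebius [OF _ _ fps_deriv_artanh fps_deriv_half_ln])
  let ?v = "fps_moebius 1"
  have "(1 + 2 * fps_X) oo ?v = 1 + 2 * ?v"
    by (simp add: fps_compose_add_distrib fps_compose_mult_distrib numeral_fps_const)
  moreover have "d ^ 2 * (1 + 2 * v) = d * (d + 2 * (v * d))" for d v :: "rat fps"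
    by (simp add: power2_eq_square algebra_simps)
  ultimately have "(1 - fps_const 1 * fps_X) ^ 2 * ((1 + 2 * fps_X) oo ?v) =
      (1 - fps_const 1 * fps_X) * (1 - fps_const 1 * fps_X + 2 * fps_X)"
    by (simp only: fps_moebius_mult)
  thus "1 - fps_X ^ 2 = (1 - fps_const 1 * fps_X) ^ 2 * ((1 + 2 * fps_X) oo ?v)"
    by (simp add: power2_eq_square algebra_simps)
qed (simp_all add: fps_artanh_def fps_half_ln_def)

lemma half_ln_eq_artanh_moebius: "fps_half_ln = fps_artanh oo fps_moebius (-1)"
proof (rule eq_compose_moebius [OF _ _ fps_deriv_half_ln fps_deriv_artanh])
  let ?v = "fps_moebius (-1)"
  have "(1 - fps_X ^ 2) oo ?v = 1 - ?v ^ 2"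
    by (simp add: fps_compose_sub_distrib fps_compose_power [symmetric])
  moreover have "d ^ 2 * (1 - v ^ 2) = d ^ 2 - (v * d) ^ 2" for d v :: "rat fps"
    by (simp add: power_mult_distrib algebra_simps)
  ultimately have "(1 - fps_const (-1) * fps_X) ^ 2 * ((1 - fps_X ^ 2) oo ?v) =
      (1 - fps_const (-1) * fps_X) ^ 2 - fps_X ^ 2"
    by (simp only: fps_moebius_mult)
  moreover have "1 - fps_const (-1) * fps_X = (1 + fps_X :: rat fps)"
    by (simp add: fps_const_neg [symmetric] del: fps_const_neg)
  moreover have "(1 + fps_X) ^ 2 - fps_X ^ 2 = (1 + 2 * fps_X :: rat fps)"
    by (simp add: power2_eq_square algebra_simps)
  ultimately show "1 + 2 * fps_X = (1 - fps_const (-1) * fps_X) ^ 2 * ((1 - fps_X ^ 2) oo ?v)"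
    by (simp only:)
qed (simp_all add: fps_artanh_def fps_half_ln_def)

text \<open>
  In \<open>A^m = B^m oo v\<close>, where \<open>v = u / (1 - c u)\<close>, the coefficient of \<open>u^n\<close> collects
  \<open>[u^j] B^m\<close> times \<open>[u^n] v^j\<close> for \<open>m \<le> j \<le> n\<close>; \<open>i = n - j\<close> is the summation index
  used here. The bound \<open>k < n\<close> keeps \<open>j\<close> positive, as the formula for \<open>[u^n] v^j\<close> requires.
\<close>

lemma egf_array_moebius:
  assumes "fps_nth B 0 = 0" and A: "A = B oo fps_moebius c" and "k < n"
  shows "egf_array A n (n - k) = (\<Sum>i\<le>k. c ^ i * (fact i * of_nat (n choose i)) *
           of_nat ((n - 1) choose i) * egf_array B (n - i) (n - k))"
proof -
  define m where "m = n - k"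
  have m: "0 < m" "m \<le> n" "k = n - m" using \<open>k < n\<close> by (auto simp: m_def)
  have "fps_nth (A ^ m) n = (\<Sum>j=0..n. fps_nth (B ^ m) j * fps_nth (fps_moebius c ^ j) n)"
    by (simp add: A fps_compose_power fps_compose_nth)
  also have "\<dots> = (\<Sum>j=m..n. fps_nth (B ^ m) j * fps_nth (fps_moebius c ^ j) n)"
    using assms(1) by (intro sum.mono_neutral_right) (auto simp: startsby_zero_power_prefix)
  also have "\<dots> = (\<Sum>j=m..n. fps_nth (B ^ m) j * (of_nat ((n - 1) choose (n - j)) * c ^ (n - j)))"
    using m by (intro sum.cong) (auto simp: fps_moebius_power_nth)
  also have "\<dots> = (\<Sum>i\<le>k. fps_nth (B ^ m) (n - i) * (of_nat ((n - 1) choose i) * c ^ i))"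
    using m by (intro sum.reindex_bij_witness [of _ "\<lambda>i. n - i" "\<lambda>j. n - j"]) auto
  finally have "egf_array A n m =
      (\<Sum>i\<le>k. fact n / fact m * (fps_nth (B ^ m) (n - i) * (of_nat ((n - 1) choose i) * c ^ i)))"
    by (simp add: egf_array_def sum_distrib_left mult_ac)
  also have "\<dots> = (\<Sum>i\<le>k. c ^ i * (fact i * of_nat (n choose i)) *
           of_nat ((n - 1) choose i) * egf_array B (n - i) m)"
  proof (rule sum.cong [OF refl])
    fix i assume "i \<in> {..k}"
    hence "i \<le> n" using \<open>k < n\<close> by simp
    hence n: "(fact n :: rat) = fact i * of_nat (n choose i) * fact (n - i)"
      by (simp add: binomial_fact)
    show "fact n / fact m * (fps_nth (B ^ m) (n - i) * (of_nat ((n - 1) choose i) * c ^ i)) =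
        c ^ i * (fact i * of_nat (n choose i)) * of_nat ((n - 1) choose i) *
        egf_array B (n - i) m"
      unfolding n by (simp add: egf_array_def)
  qed
  finally show ?thesis by (simp add: m_def)
qed

section \<open>From integer points to field elements\<close>

lemma poly_map_of_rat_of_nat:
  "poly (map_poly of_rat p) (of_nat n :: 'a::field_char_0) = of_rat (poly p (of_nat n))"
  by (simp add: poly_altdef degree_map_poly coeff_map_poly of_rat_sum of_rat_mult of_rat_power)

lemma poly_eq_if_agree_on_naturals:
  fixes p q :: "'a::field_char_0 poly"
  assumes "\<And>n. n > k \<Longrightarrow> poly p (of_nat n) = poly q (of_nat n)"
  shows "p = q"
proof (rule ccontr)
  assume "p \<noteq> q"
  hence "finite {x. poly (p - q) x = 0}" by (intro poly_roots_finite) simp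
  moreover have "of_nat ` {k<..} \<subseteq> {x. poly (p - q) x = 0}" using assms by auto
  ultimately have "finite (of_nat ` {k<..} :: 'a set)" by (rule rev_finite_subset)
  thus False by (simp add: finite_image_iff inj_on_def infinite_Ioi)
qed

lemma gchoose_polynomial:
  obtains p :: "'a::field_char_0 poly" where "\<And>y. poly p y = y gchoose i"
proof
  show "poly (smult (1 / fact i) (\<Prod>j=0..<i. [:- of_nat j, 1:])) y = y gchoose i" for y :: 'a
    by (simp add: gbinomial_prod_rev poly_prod algebra_simps)
qed

lemma prod_falling_split:
  fixes y :: "'a::field_char_0"
  assumes "i \<le> k"
  shows "(\<Prod>j\<le>k. y - of_nat j) =
    fact i * (y gchoose i) * (\<Prod>j\<le>k - i. y - of_nat i - of_nat j)"
proof -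
  have "(\<Prod>j\<le>k. y - of_nat j) = (\<Prod>j\<in>{0..<i} \<union> {i..k}. y - of_nat j)"
    using assms by (intro prod.cong) auto
  also have "\<dots> = (\<Prod>j=0..<i. y - of_nat j) * (\<Prod>j=i..k. y - of_nat j)"
    by (intro prod.union_disjoint) auto
  also have "(\<Prod>j=i..k. y - of_nat j) = (\<Prod>j\<le>k - i. y - of_nat i - of_nat j)"
    using assms by (intro prod.reindex_bij_witness [of _ "\<lambda>j. i + j" "\<lambda>j. j - i"])
      (auto simp: algebra_simps of_nat_diff)
  finally show ?thesis by (simp add: gbinomial_mult_fact)
qed

text \<open>
  The Lah relation holds at all integers above \<open>k\<close>, hence as an identity of polynomials in
  \<open>y\<close>; dividing by the falling factorial of \<open>y\<close>, which is nonzero by assumption,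
  absorbs the factor \<open>i! (y choose i)\<close> of the \<open>i\<close>-th term.
\<close>

lemma diagonal_lah_relation:
  fixes f g :: "nat \<Rightarrow> nat \<Rightarrow> rat" and c :: rat and y :: "'a::field_char_0"
  assumes f: "\<And>k. \<exists>!p. \<forall>n\<ge>k. poly p (of_nat n) = f n (n - k)"
    and g: "\<And>k. \<exists>!p. \<forall>n\<ge>k. poly p (of_nat n) = g n (n - k)"
    and lah: "\<And>n. k < n \<Longrightarrow> f n (n - k) = (\<Sum>i\<le>k. c ^ i * (fact i * of_nat (n choose i)) *
           of_nat ((n - 1) choose i) * g (n - i) (n - k))"
    and y: "\<And>j. y \<noteq> of_nat j"
  shows "over_falling (diagonal_poly f k) k y =
    (\<Sum>i\<le>k. of_rat c ^ i * ((y - 1) gchoose i) *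
       over_falling (diagonal_poly g (k - i)) (k - i) (y - of_nat i))"
proof -
  define P where "P k = (map_poly of_rat (diagonal_poly f k) :: 'a poly)" for k
  define Q where "Q k = (map_poly of_rat (diagonal_poly g k) :: 'a poly)" for k
  have P: "poly (P k) (of_nat n) = of_rat (f n (n - k))" if "k \<le> n" for k n
    using theI' [OF f [of k]] that by (simp add: P_def diagonal_poly_def poly_map_of_rat_of_nat)
  have Q: "poly (Q k) (of_nat n) = of_rat (g n (n - k))" if "k \<le> n" for k n
    using theI' [OF g [of k]] that by (simp add: Q_def diagonal_poly_def poly_map_of_rat_of_nat)
  have "\<exists>b :: 'a poly. \<forall>y. poly b y = y gchoose i" for i
    by (rule gchoose_polynomial [of i]) blast
  then obtain b :: "nat \<Rightarrow> 'a poly" where b: "\<And>i y. poly (b i) y = y gchoose i" by metis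
  define R where "R = (\<Sum>i\<le>k. smult (of_rat c ^ i * fact i) (b i) *
      pcompose (b i) [:-1, 1:] * pcompose (Q (k - i)) [:- of_nat i, 1:])"
  have R: "poly R y = (\<Sum>i\<le>k. of_rat c ^ i * (fact i * (y gchoose i)) *
      ((y - 1) gchoose i) * poly (Q (k - i)) (y - of_nat i))" for y
    by (simp add: R_def poly_sum poly_pcompose b mult_ac)
  have "P k = R"
  proof (rule poly_eq_if_agree_on_naturals [of k])
    fix n assume n: "k < n"
    have "poly R (of_nat n) = (\<Sum>i\<le>k. of_rat (c ^ i * (fact i * of_nat (n choose i)) *
           of_nat ((n - 1) choose i) * g (n - i) (n - k)))"
      unfolding R
    proof (rule sum.cong [OF refl])
      fix i assume i: "i \<in> {..k}"
      have "of_nat n - 1 = (of_nat (n - 1) :: 'a)" "of_nat n - of_nat i = (of_nat (n - i) :: 'a)"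
        using n i by (simp_all add: of_nat_diff)
      moreover have "of_rat (fact i) = (fact i :: 'a)"
        by (metis of_nat_fact of_rat_of_nat_eq)
      moreover have "poly (Q (k - i)) (of_nat (n - i)) = of_rat (g (n - i) (n - k))"
        using n i by (subst Q) auto
      ultimately show "of_rat c ^ i * (fact i * (of_nat n gchoose i)) *
          ((of_nat n - 1) gchoose i) * poly (Q (k - i)) (of_nat n - of_nat i) =
          (of_rat (c ^ i * (fact i * of_nat (n choose i)) *
           of_nat ((n - 1) choose i) * g (n - i) (n - k)) :: 'a)"
        by (simp only: of_rat_mult of_rat_power of_rat_of_nat_eq binomial_gbinomial [symmetric])
    qed
    thus "poly (P k) (of_nat n) = poly R (of_nat n)"
      using n by (simp add: P lah of_rat_sum)
  qed
  hence "over_falling (diagonal_poly f k) k y = poly R y / (\<Prod>j\<le>k. y - of_nat j)"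
    by (simp add: over_falling_def P_def)
  also have "\<dots> = (\<Sum>i\<le>k. of_rat c ^ i * ((y - 1) gchoose i) *
       over_falling (diagonal_poly g (k - i)) (k - i) (y - of_nat i))"
    unfolding R sum_divide_distrib
  proof (rule sum.cong [OF refl])
    fix i assume i: "i \<in> {..k}"
    have "(\<Prod>j\<le>k. y - of_nat j) \<noteq> 0" using y by simp
    hence "fact i * (y gchoose i) \<noteq> 0"
      using i prod_falling_split [of i k y] by (metis atMost_iff mult_zero_left)
    thus "of_rat c ^ i * (fact i * (y gchoose i)) * ((y - 1) gchoose i) *
        poly (Q (k - i)) (y - of_nat i) / (\<Prod>j\<le>k. y - of_nat j) =
        of_rat c ^ i * ((y - 1) gchoose i) *
        over_falling (diagonal_poly g (k - i)) (k - i) (y - of_nat i)"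
      using i by (simp add: prod_falling_split [of i k] over_falling_def Q_def)
  qed
  finally show ?thesis .
qed

lemma tanh_polynomial_eq_sum_stirling:
  fixes y :: "'a::field_char_0"
  assumes "\<And>j. y \<noteq> of_nat j"
  shows "tanh_polynomial k y =
    (\<Sum>i\<le>k. ((y - 1) gchoose i) * stirling_polynomial (k - i) (y - of_nat i))"
proof -
  have "artanh_number n (n - k) = (\<Sum>i\<le>k. 1 ^ i * (fact i * of_nat (n choose i)) *
      of_nat ((n - 1) choose i) * scaled_stirling (n - i) (n - k))" if "k < n" for n
    unfolding artanh_number_eq_egf_array scaled_stirling_eq_egf_array
    by (rule egf_array_moebius [OF _ artanh_eq_half_ln_moebius that]) (simp add: fps_half_ln_def)
  from diagonal_lah_relation [OF diagonal_artanh_ex1 diagonal_stirling_ex1 this assms]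
  show ?thesis by (simp add: tanh_polynomial_def stirling_polynomial_def)
qed

lemma stirling_polynomial_eq_sum_tanh:
  fixes y :: "'a::field_char_0"
  assumes "\<And>j. y \<noteq> of_nat j"
  shows "stirling_polynomial k y =
    (\<Sum>i\<le>k. (-1) ^ i * ((y - 1) gchoose i) * tanh_polynomial (k - i) (y - of_nat i))"
proof -
  have "scaled_stirling n (n - k) = (\<Sum>i\<le>k. (-1) ^ i * (fact i * of_nat (n choose i)) *
      of_nat ((n - 1) choose i) * artanh_number (n - i) (n - k))" if "k < n" for n
    unfolding artanh_number_eq_egf_array scaled_stirling_eq_egf_array
    by (rule egf_array_moebius [OF _ half_ln_eq_artanh_moebius that]) (simp add: fps_artanh_def)
  from diagonal_lah_relation [OF diagonal_stirling_ex1 diagonal_artanh_ex1 this assms]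
  show ?thesis by (simp add: tanh_polynomial_def stirling_polynomial_def of_rat_minus)
qed

text \<open>
  Reversing the sum turns the argument \<open>x - i\<close>, taken at \<open>k - x\<close>, into \<open>i - x\<close>.
\<close>

lemma sum_reflect_at:
  fixes h :: "nat \<Rightarrow> nat \<Rightarrow> 'a::comm_ring_1 \<Rightarrow> 'a"
  shows "(\<Sum>i\<le>k. h i (k - i) (of_nat k - x - of_nat i)) =
    (\<Sum>i\<le>k. h (k - i) i (of_nat i - x))"
  by (rule sum.reindex_bij_witness [of _ "\<lambda>i. k - i" "\<lambda>i. k - i"])
     (auto simp: of_nat_diff algebra_simps)

lemma indeterminate_plus_of_nat_neq:
  "to_fract [:0, 1 :: rat:] + of_nat j \<noteq> of_nat n"
proof
  have of_nat: "to_fract (of_nat m :: rat poly) = of_nat m" for m :: nat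
    by (induction m) simp_all
  assume "to_fract [:0, 1 :: rat:] + of_nat j = of_nat n"
  hence "to_fract ([:0, 1 :: rat:] + of_nat j) = to_fract (of_nat n)"
    by (simp add: of_nat)
  thus False by (simp add: of_nat_poly)
qed

theorem proposition3p2:
  fixes k :: nat
  defines "x \<equiv> to_fract [:0, 1 :: rat:]"
  shows "tanh_polynomial k x =
           (\<Sum>i\<le>k. ((x - 1) gchoose i) * stirling_polynomial (k - i) (x - of_nat i)) \<and>
         tanh_polynomial k (of_nat k - x) =
           (\<Sum>i\<le>k. ((of_nat k - x - 1) gchoose (k - i)) * stirling_polynomial i (of_nat i - x)) \<and>
         stirling_polynomial k x =
           (\<Sum>i\<le>k. (-1) ^ i * ((x - 1) gchoose i) * tanh_polynomial (k - i) (x - of_nat i)) \<and>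
         stirling_polynomial k (of_nat k - x) =
           (\<Sum>i\<le>k. (-1) ^ (k - i) * ((of_nat k - x - 1) gchoose (k - i)) *
              tanh_polynomial i (of_nat i - x))"
proof -
  have x: "x \<noteq> of_nat j" for j
    using indeterminate_plus_of_nat_neq [of 0 j] by (simp add: x_def)
  have kx: "of_nat k - x \<noteq> of_nat j" for j
    using indeterminate_plus_of_nat_neq [of j k] by (auto simp: x_def algebra_simps)
  show ?thesis
  proof (intro conjI)
    show "tanh_polynomial k x =
        (\<Sum>i\<le>k. ((x - 1) gchoose i) * stirling_polynomial (k - i) (x - of_nat i))"
      by (rule tanh_polynomial_eq_sum_stirling [OF x])
    show "stirling_polynomial k x =
        (\<Sum>i\<le>k. (-1) ^ i * ((x - 1) gchoose i) * tanh_polynomial (k - i) (x - of_nat i))"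
      by (rule stirling_polynomial_eq_sum_tanh [OF x])
    show "tanh_polynomial k (of_nat k - x) =
        (\<Sum>i\<le>k. ((of_nat k - x - 1) gchoose (k - i)) * stirling_polynomial i (of_nat i - x))"
      unfolding tanh_polynomial_eq_sum_stirling [OF kx]
      by (rule sum_reflect_at [of "\<lambda>i j y. ((of_nat k - x - 1) gchoose i) *
        stirling_polynomial j y"])
    show "stirling_polynomial k (of_nat k - x) =
        (\<Sum>i\<le>k. (-1) ^ (k - i) * ((of_nat k - x - 1) gchoose (k - i)) *
          tanh_polynomial i (of_nat i - x))"
      unfolding stirling_polynomial_eq_sum_tanh [OF kx]
      by (rule sum_reflect_at [of "\<lambda>i j y. (-1) ^ i * ((of_nat k - x - 1) gchoose i) *
        tanh_polynomial j y"])
  qed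
qed

end
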